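(* Let $\mathbf{A}=(a_k)_{k=0}^\infty$ be a nonnegative real sequence such that $a_k>0$ for $0\le k\le 3$ and $a_k=0$ for $k\ge 4$. Then $\Lambda_{\mathbf{A}}((b_k)_{k=0}^\infty)\in TP_\infty$ for every $(b_k)_{k=0}^\infty\in TP_\infty$ if and only if both polynomials $\sum_{k=0}^3 a_kx^k$ and $\sum_{k=1}^3 a_kx^k$ have only real (and nonpositive) zeros. Moreover, $\Lambda_{\mathbf{A}}$ maps $TP_\infty$ into $TP_\infty$ if and only if $\Lambda_{\mathbf{A}}$ maps $TP_3$ into $TP_\infty$.
   Context: For a real sequence $(c_k)_{k=0}^\infty$ consider the infinite upper triangular Toeplitz matrix $\|c_{j-i}\|_{i,j=0}^\infty$, with $c_k=0$ for $k<0$. For $m\in\mathbb{N}$, the sequence is called $m$-times positive, written $(c_k)\in TP_m$, if all minors of this matrix of orders less than or equal to $m$ are nonnegative. It is called totally positive, written $(c_k)\in TP_\infty$, if all minors of this matrix are nonnegative. For a nonnegative sequence $\mathbf{A}=(a_k)_{k=0}^\infty$, the operator $\Lambda_{\mathbf{A}}$ acts on real sequences by $\Lambda_{\mathbf{A}}((b_k)_{k=0}^\infty)=(a_kb_k)_{k=0}^\infty$. *)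

theory Defs
  imports Complex_Main "HOL-Computational_Algebra.Polynomial" "Jordan_Normal_Form.Determinant"
begin

definition toeplitz :: "(nat \<Rightarrow> real) \<Rightarrow> nat \<Rightarrow> nat \<Rightarrow> real" where
  "toeplitz c i j = (if i \<le> j then c (j - i) else 0)"

text \<open>The minor of order \<open>r\<close> of an infinite matrix \<open>M\<close> with rows
  \<open>f 0 < \<dots> < f (r - 1)\<close> and columns \<open>g 0 < \<dots> < g (r - 1)\<close>. The values of \<open>f\<close> and \<open>g\<close>
  at arguments \<open>\<ge> r\<close> play no role.\<close>

definition minor :: "(nat \<Rightarrow> nat \<Rightarrow> real) \<Rightarrow> nat \<Rightarrow> (nat \<Rightarrow> nat) \<Rightarrow> (nat \<Rightarrow> nat) \<Rightarrow> real" where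
  "minor M r f g = det (mat r r (\<lambda>(p, q). M (f p) (g q)))"

definition nonneg_minors :: "(nat \<Rightarrow> nat \<Rightarrow> real) \<Rightarrow> nat \<Rightarrow> bool" where
  "nonneg_minors M r \<longleftrightarrow>
     (\<forall>f g. strict_mono_on {..<r} f \<longrightarrow> strict_mono_on {..<r} g \<longrightarrow> 0 \<le> minor M r f g)"

text \<open>Order \<open>0\<close> is included below, harmlessly, since the empty minor is \<open>1\<close>.\<close>

definition TP :: "nat \<Rightarrow> (nat \<Rightarrow> real) set" where
  "TP m = {c. \<forall>r\<le>m. nonneg_minors (toeplitz c) r}"

definition TP_inf :: "(nat \<Rightarrow> real) set" where
  "TP_inf = {c. \<forall>r. nonneg_minors (toeplitz c) r}"

definition Lam :: "(nat \<Rightarrow> real) \<Rightarrow> (nat \<Rightarrow> real) \<Rightarrow> nat \<Rightarrow> real" where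
  "Lam a b = (\<lambda>k. a k * b k)"

text \<open>All zeros are taken in the complex plane.\<close>

definition only_real_nonpos_zeros :: "real poly \<Rightarrow> bool" where
  "only_real_nonpos_zeros p \<longleftrightarrow>
     (\<forall>z::complex. poly (map_poly complex_of_real p) z = 0 \<longrightarrow> z \<in> \<real> \<and> Re z \<le> 0)"

end

theory Submission
  imports Defs
begin

text \<open>\<^emph>\<open>Necessity.\<close> The operator is applied to the two totally positive sequences \<open>1, 1, 1, \<dots>\<close> and
  \<open>0, 1, 1, \<dots>\<close>, so that \<open>a\<close> and \<open>0, a 1, a 2, a 3, 0, \<dots>\<close> are totally positive. Write
  \<open>p(x) = \<Sum> a k x^k\<close>. The Hessenberg determinants \<open>det (c (1 + q - p))\<close>, with \<open>p, q < n\<close>, are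
  contiguous minors of the Toeplitz matrix of \<open>c\<close>, and also of that of \<open>0, c 0, c 1, \<dots>\<close>. Hence they
  are nonnegative if one of these two sequences is totally positive. Up to the factor
  \<open>c 0 ^ (n + 1)\<close> they are the power series coefficients of \<open>1 / (\<Sum> c k (-x)^k)\<close>, so they satisfy
  a linear recurrence. A nonzero real solution of
  \<open>g (n + 2) = s g (n + 1) - g n\<close> with \<open>\<bar>s\<bar> < 2\<close> has bounded partial sums but does not tend to zero
  (a positive definite quadratic form is conserved). Hence it cannot be nonnegative. If
  \<open>4 a 1 a 3 > (a 2)^2\<close>, the determinants for \<open>c = (a 1, a 2, a 3, 0, \<dots>)\<close> would, after rescaling,
  be such a nonnegative solution, so \<open>4 a 1 a 3 \<le> (a 2)^2\<close>. If \<open>p\<close> had a nonreal zero, then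
  \<open>p(x) = a 3 (x + \<rho>) (x^2 + \<sigma> x + \<tau>^2)\<close> with \<open>\<bar>\<sigma>\<bar> < 2 \<tau>\<close>, and the inequality just obtained together
  with \<open>a 2 > 0\<close> forces \<open>\<rho> > \<tau>\<close>. After rescaling, the Hessenberg determinants for \<open>c = a\<close> give a sequence
  \<open>w \<ge> 0\<close> for which \<open>g n = r w (n + 1) - w n\<close>, with \<open>r = \<rho> / \<tau> > 1\<close>, is an oscillating
  sequence as above. Summing shows that \<open>w\<close> is summable, so \<open>g\<close> tends to zero, a contradiction.

  \<^emph>\<open>Sufficiency.\<close> Let \<open>b \<in> TP 3\<close> and \<open>c k = a k * b k\<close>. Multiplying the generating function by a
  factor \<open>\<alpha> + \<beta> x\<close> with \<open>\<alpha>, \<beta> \<ge> 0\<close> preserves total positivity.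
  Since \<open>c\<close> is nonnegative, it therefore suffices that
  \<open>f(y) = c 0 - c 1 y + c 2 y^2 - c 3 y^3\<close> has only real zeros. If one of \<open>b 0, \<dots>, b 3\<close> vanishes,
  only a quadratic has to be examined. In the main case \<open>b 0, \<dots>, b 3 > 0\<close>
  the sign changes of \<open>f\<close> are exhibited explicitly. The discriminant inequalities
  \<open>4 a 1 a 3 \<le> (a 2)^2\<close> and \<open>b 1 b 3 \<le> (b 2)^2\<close> give \<open>f(c 2 / (2 c 3)) \<ge> c 0 > 0\<close>. On the other
  hand, \<open>p(-v) \<le> 0\<close> for some \<open>0 < v < a 2 / (2 a 3)\<close>, and \<open>u = v b 0 / b 1\<close> satisfies
  \<open>f(u) \<le> 0\<close>. This step uses the inequalities \<open>\<mu> \<le> 1\<close> and \<open>\<nu> \<ge> 2 \<mu> - 1\<close>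
  for \<open>\<mu> = b 0 b 2 / (b 1)^2\<close> and \<open>\<nu> = (b 0)^2 b 3 / (b 1)^3\<close>, the second of which is the
  nonnegativity of a minor of order three.

  Since \<open>TP_inf \<subseteq> TP 3\<close>, these two implications give both equivalences.\<close>

section \<open>Determinants of matrices given by their entries\<close>

lemma det_first_column:
  fixes M :: "nat \<Rightarrow> nat \<Rightarrow> real"
  assumes "\<And>p. 0 < p \<Longrightarrow> p \<le> n \<Longrightarrow> M p 0 = 0"
  shows "det (mat (Suc n) (Suc n) (\<lambda>(p, q). M p q)) =
    M 0 0 * det (mat n n (\<lambda>(p, q). M (Suc p) (Suc q)))"
proof -
  let ?A = "mat (Suc n) (Suc n) (\<lambda>(p, q). M p q)"
  have "det ?A = (\<Sum>i<Suc n. ?A $$ (i, 0) * cofactor ?A i 0)"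
    by (rule laplace_expansion_column) auto
  also have "\<dots> = (\<Sum>i\<in>{0}. ?A $$ (i, 0) * cofactor ?A i 0)"
    by (rule sum.mono_neutral_right) (auto simp: assms)
  also have "mat_delete ?A 0 0 = mat n n (\<lambda>(p, q). M (Suc p) (Suc q))"
    by (rule eq_matI) (auto simp: mat_delete_def)
  then have "(\<Sum>i\<in>{0}. ?A $$ (i, 0) * cofactor ?A i 0) =
      M 0 0 * det (mat n n (\<lambda>(p, q). M (Suc p) (Suc q)))"
    by (simp add: cofactor_def)
  finally show ?thesis .
qed

lemma det_row_combination:
  fixes A B C :: "nat \<Rightarrow> nat \<Rightarrow> real"
  assumes k: "k < n"
    and B: "\<And>p q. p \<noteq> k \<Longrightarrow> B p q = A p q"
    and C: "\<And>p q. p \<noteq> k \<Longrightarrow> C p q = A p q"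
    and A: "\<And>q. A k q = \<alpha> * B k q + \<beta> * C k q"
  shows "det (mat n n (\<lambda>(p, q). A p q)) =
    \<alpha> * det (mat n n (\<lambda>(p, q). B p q)) + \<beta> * det (mat n n (\<lambda>(p, q). C p q))"
proof -
  let ?M = "\<lambda>X. mat n n (\<lambda>(p, q). X p q) :: real mat"
  have exp: "det (?M X) = (\<Sum>j<n. X k j * cofactor (?M X) k j)" for X
  proof -
    have "det (?M X) = (\<Sum>j<n. ?M X $$ (k, j) * cofactor (?M X) k j)"
      using k by (intro laplace_expansion_row) auto
    then show ?thesis using k by simp
  qed
  have "mat_delete (?M B) k j = mat_delete (?M A) k j"
    "mat_delete (?M C) k j = mat_delete (?M A) k j" for j
    by (auto intro!: eq_matI simp: mat_delete_def B C)
  then have "cofactor (?M B) k j = cofactor (?M A) k j"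
    "cofactor (?M C) k j = cofactor (?M A) k j" for j
    by (simp_all add: cofactor_def)
  then show ?thesis
    by (simp add: exp A sum_distrib_left sum.distrib algebra_simps)
qed

lemma det_equal_rows:
  fixes M :: "nat \<Rightarrow> nat \<Rightarrow> real"
  assumes "i < n" "j < n" "i \<noteq> j" "\<And>q. M i q = M j q"
  shows "det (mat n n (\<lambda>(p, q). M p q)) = 0"
  by (rule det_identical_rows[of _ n i j]) (use assms in \<open>auto intro!: eq_vecI\<close>)

lemma det_zero_row:
  fixes M :: "nat \<Rightarrow> nat \<Rightarrow> real"
  assumes "i < n" "\<And>q. q < n \<Longrightarrow> M i q = 0"
  shows "det (mat n n (\<lambda>(p, q). M p q)) = 0"
proof -
  have "det (mat n n (\<lambda>(p, q). M p q)) =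
    (\<Sum>j<n. mat n n (\<lambda>(p, q). M p q) $$ (i, j) * cofactor (mat n n (\<lambda>(p, q). M p q)) i j)"
    using assms by (intro laplace_expansion_row) auto
  then show ?thesis using assms by simp
qed

lemma strict_mono_on_Suc:
  "strict_mono_on {..<Suc r} f \<Longrightarrow> strict_mono_on {..<r} (\<lambda>p. f (Suc p) :: nat)"
  by (auto simp: strict_mono_on_def)

lemma det_mat_2:
  fixes M :: "nat \<Rightarrow> nat \<Rightarrow> real"
  shows "det (mat 2 2 (\<lambda>(p, q). M p q)) = M 0 0 * M 1 1 - M 0 1 * M 1 0"
proof -
  have "det (mat 2 2 (\<lambda>(p, q). M p q)) =
      (\<Sum>j<2. mat 2 2 (\<lambda>(p, q). M p q) $$ (0, j) * cofactor (mat 2 2 (\<lambda>(p, q). M p q)) 0 j)"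
    by (rule laplace_expansion_row) auto
  then show ?thesis
    by (simp add: numeral_2_eq_2 cofactor_def mat_delete_def det_single)
qed

section \<open>Basic totally positive sequences\<close>

text \<open>The rows are indicator functions of final segments, decreasing weakly from each row to the next, so
  the determinant is zero or one.\<close>

lemma det_staircase_nonneg:
  assumes "strict_mono_on {..<r} f" "strict_mono_on {..<r} (g :: nat \<Rightarrow> nat)"
  shows "0 \<le> det (mat r r (\<lambda>(p, q). if f p \<le> g q then 1 else 0 :: real))"
  using assms
proof (induction r arbitrary: f g)
  case 0
  then show ?case by simp
next
  case (Suc r)
  let ?M = "\<lambda>p q. if f p \<le> g q then 1 else 0 :: real"
  have gq: "g 0 \<le> g q" if "q < Suc r" for q
    using Suc.prems(2) that by (cases q) (auto simp: strict_mono_on_def less_imp_le)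
  have fp: "f 1 \<le> f p" if "0 < p" "p < Suc r" for p
    using Suc.prems(1) that by (cases "p = 1") (auto simp: strict_mono_on_def less_imp_le)
  \<comment> \<open>If the first column starts with two ones, the first two rows are constant and equal.
    Otherwise only its top entry can be nonzero.\<close>
  show ?case
  proof (cases "0 < r \<and> f 1 \<le> g 0")
    case True
    then have "f 0 \<le> f 1" using Suc.prems(1) by (auto simp: strict_mono_on_def less_imp_le)
    then have "f 0 \<le> g q" "f 1 \<le> g q" if "q < Suc r" for q
      using gq[OF that] True by auto
    then have "det (mat (Suc r) (Suc r) (\<lambda>(p, q). ?M p q)) = 0"
      using True by (intro det_identical_rows[of _ "Suc r" 0 1]) (auto intro!: eq_vecI)
    then show ?thesis by simp
  next
    case False
    then have "?M p 0 = 0" if "0 < p" "p \<le> r" for p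
      using fp[of p] that by auto
    then have "det (mat (Suc r) (Suc r) (\<lambda>(p, q). ?M p q)) =
        ?M 0 0 * det (mat r r (\<lambda>(p, q). ?M (Suc p) (Suc q)))"
      by (rule det_first_column)
    moreover have "0 \<le> det (mat r r (\<lambda>(p, q). ?M (Suc p) (Suc q)))"
      by (rule Suc.IH) (auto intro: strict_mono_on_Suc Suc.prems)
    ultimately show ?thesis by auto
  qed
qed

lemma det_incidence_nonneg:
  assumes "strict_mono_on {..<r} f" "strict_mono_on {..<r} (g :: nat \<Rightarrow> nat)"
  shows "0 \<le> det (mat r r (\<lambda>(p, q). if f p = g q then 1 else 0 :: real))"
  using assms
proof (induction r arbitrary: f g)
  case 0
  then show ?case by simp
next
  case (Suc r)
  let ?M = "\<lambda>p q. if f p = g q then 1 else 0 :: real"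
  have gq: "g 0 \<le> g q" if "q < Suc r" for q
    using Suc.prems(2) that by (cases q) (auto simp: strict_mono_on_def less_imp_le)
  have fp: "f 0 < f p" if "0 < p" "p < Suc r" for p
    using Suc.prems(1) that by (auto simp: strict_mono_on_def)
  show ?case
  proof (cases "f 0 < g 0")
    case True
    then have "?M 0 q = 0" if "q < Suc r" for q
      using gq[OF that] by auto
    then have "det (mat (Suc r) (Suc r) (\<lambda>(p, q). ?M p q)) = 0"
      by (intro det_zero_row[of 0]) auto
    then show ?thesis by simp
  next
    case False
    then have "?M p 0 = 0" if "0 < p" "p \<le> r" for p
      using fp[of p] that by auto
    then have "det (mat (Suc r) (Suc r) (\<lambda>(p, q). ?M p q)) =
        ?M 0 0 * det (mat r r (\<lambda>(p, q). ?M (Suc p) (Suc q)))"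
      by (rule det_first_column)
    moreover have "0 \<le> det (mat r r (\<lambda>(p, q). ?M (Suc p) (Suc q)))"
      by (rule Suc.IH) (auto intro: strict_mono_on_Suc Suc.prems)
    ultimately show ?thesis by auto
  qed
qed

lemma ones_TP_inf: "(\<lambda>k. 1) \<in> TP_inf"
proof -
  have "toeplitz (\<lambda>k. 1) = (\<lambda>i j. if i \<le> j then 1 else 0)"
    by (auto simp: toeplitz_def fun_eq_iff)
  then show ?thesis
    by (auto simp: TP_inf_def nonneg_minors_def minor_def intro: det_staircase_nonneg)
qed

lemma shifted_ones_TP_inf: "(\<lambda>k. if k = 0 then 0 else 1) \<in> TP_inf"
proof -
  have "toeplitz (\<lambda>k. if k = 0 then 0 else 1) = (\<lambda>i j. if Suc i \<le> j then 1 else 0)"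
    by (auto simp: toeplitz_def fun_eq_iff)
  then show ?thesis
    using det_staircase_nonneg[of _ "\<lambda>p. Suc (_ p)"]
    by (auto simp: TP_inf_def nonneg_minors_def minor_def strict_mono_on_def simp del: Suc_le_eq)
qed

lemma unit_TP_inf: "(\<lambda>k. if k = 0 then 1 else 0) \<in> TP_inf"
proof -
  have "toeplitz (\<lambda>k. if k = 0 then 1 else 0) = (\<lambda>i j. if i = j then 1 else 0)"
    by (auto simp: toeplitz_def fun_eq_iff)
  then show ?thesis
    by (auto simp: TP_inf_def nonneg_minors_def minor_def intro: det_incidence_nonneg)
qed

section \<open>Linear factors preserve total positivity\<close>

text \<open>The coefficient sequence of \<open>(\<alpha> + \<beta> x) * (\<Sum>k. c k * x ^ k)\<close>.\<close>

abbreviation linmul :: "real \<Rightarrow> real \<Rightarrow> (nat \<Rightarrow> real) \<Rightarrow> nat \<Rightarrow> real" where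
  "linmul \<alpha> \<beta> c \<equiv> \<lambda>k. \<alpha> * c k + (if k = 0 then 0 else \<beta> * c (k - 1))"

text \<open>Row \<open>i\<close> of the new Toeplitz matrix is \<open>\<alpha>\<close> times row \<open>i\<close> plus \<open>\<beta>\<close> times row \<open>i + 1\<close> of the old
  one. Expanding a minor by multilinearity in the rows therefore gives a nonnegative combination of
  old minors, and of determinants with two equal rows.\<close>

lemma TP_inf_linear_factor:
  assumes c: "c \<in> TP_inf" and "0 \<le> \<alpha>" "0 \<le> \<beta>"
  shows "linmul \<alpha> \<beta> c \<in> TP_inf" (is "?d \<in> _")
proof -
  have T: "toeplitz ?d i j = \<alpha> * toeplitz c i j + \<beta> * toeplitz c (Suc i) j" for i j
    by (auto simp: toeplitz_def)
  have "0 \<le> minor (toeplitz ?d) r f g"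
    if f: "strict_mono_on {..<r} f" and g: "strict_mono_on {..<r} g" for r f g
  proof -
    \<comment> \<open>The first \<open>k\<close> rows are new ones, and the rows from \<open>k\<close> on are already split, the row index
      \<open>h p\<close> recording the summand chosen in row \<open>p\<close>.\<close>
    let ?M = "\<lambda>k h p q. if p < k then toeplitz ?d (f p) (g q) else toeplitz c (h p) (g q)"
    have main: "0 \<le> det (mat r r (\<lambda>(p, q). ?M k h p q))"
      if "k \<le> r" and "\<And>p. h p = f p \<or> h p = Suc (f p)" for k h
      using that
    proof (induction k arbitrary: h)
      case 0
      have le: "h p \<le> h q" if "p < q" "q < r" for p q
      proof -
        have "f p < f q" using f that by (auto simp: strict_mono_on_def)
        then show ?thesis using 0(2)[of p] 0(2)[of q] by auto
      qed
      show ?case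
      proof (cases "strict_mono_on {..<r} h")
        case True
        then show ?thesis
          using c g by (auto simp: TP_inf_def nonneg_minors_def minor_def)
      next
        case False
        then obtain p q where pq: "p < q" "q < r" "\<not> h p < h q"
          by (auto simp: strict_mono_on_def)
        then have "h p = h q" using le[of p q] by auto
        then have "det (mat r r (\<lambda>(p, q). ?M 0 h p q)) = 0"
          using pq by (intro det_equal_rows[of p _ q]) auto
        then show ?thesis by simp
      qed
    next
      case (Suc k)
      have "det (mat r r (\<lambda>(p, q). ?M (Suc k) h p q)) =
          \<alpha> * det (mat r r (\<lambda>(p, q). ?M k (h(k := f k)) p q)) +
          \<beta> * det (mat r r (\<lambda>(p, q). ?M k (h(k := Suc (f k))) p q))"
        by (rule det_row_combination[where k = k])
          (use Suc.prems in \<open>auto simp: T less_Suc_eq\<close>)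
      moreover have "0 \<le> det (mat r r (\<lambda>(p, q). ?M k (h(k := f k)) p q))"
        "0 \<le> det (mat r r (\<lambda>(p, q). ?M k (h(k := Suc (f k))) p q))"
        by (rule Suc.IH; use Suc.prems in auto)+
      ultimately show ?case using assms by simp
    qed
    have "mat r r (\<lambda>(p, q). ?M r f p q) = mat r r (\<lambda>(p, q). toeplitz ?d (f p) (g q))"
      by (rule eq_matI) auto
    then show ?thesis using main[of r f] by (simp add: minor_def)
  qed
  then show ?thesis by (auto simp: TP_inf_def nonneg_minors_def)
qed

lemma quadratic_factors:
  fixes e0 e1 e2 :: real
  assumes e: "0 \<le> e0" "0 \<le> e1" "0 \<le> e2" and disc: "4 * e0 * e2 \<le> e1\<^sup>2"
  obtains \<alpha>1 \<beta>1 \<alpha>2 \<beta>2 where "0 \<le> \<alpha>1" "0 \<le> \<beta>1" "0 \<le> \<alpha>2" "0 \<le> \<beta>2"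
    "e0 = \<alpha>1 * \<alpha>2" "e1 = \<alpha>1 * \<beta>2 + \<beta>1 * \<alpha>2" "e2 = \<beta>1 * \<beta>2"
proof (cases "e2 = 0")
  case True
  then show ?thesis using that[of e0 e1 1 0] e by auto
next
  case False
  then have e2: "0 < e2" using e by simp
  define q where "q = sqrt (e1\<^sup>2 - 4 * e0 * e2)"
  have q: "0 \<le> q" "q\<^sup>2 = e1\<^sup>2 - 4 * e0 * e2" using disc by (simp_all add: q_def)
  have "q \<le> e1" by (rule power2_le_imp_le) (use q e in auto)
  show ?thesis
  proof (rule that[of "(e1 + q) / 2" e2 "(e1 - q) / (2 * e2)" 1])
    show "e0 = (e1 + q) / 2 * ((e1 - q) / (2 * e2))"
      using q(2) e2 by (simp add: field_simps power2_eq_square)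
    show "e1 = (e1 + q) / 2 * 1 + e2 * ((e1 - q) / (2 * e2))"
      using e2 by (simp add: field_simps)
  qed (use e2 e q \<open>q \<le> e1\<close> in auto)
qed

lemma TP_inf_quadratic:
  assumes nonneg: "\<And>k. 0 \<le> c k" and zero: "\<forall>k\<ge>3. c k = 0"
    and disc: "4 * c 0 * c 2 \<le> (c 1)\<^sup>2"
  shows "c \<in> TP_inf"
proof -
  obtain \<alpha>1 \<beta>1 \<alpha>2 \<beta>2 where f: "0 \<le> \<alpha>1" "0 \<le> \<beta>1" "0 \<le> \<alpha>2" "0 \<le> \<beta>2"
    "c 0 = \<alpha>1 * \<alpha>2" "c 1 = \<alpha>1 * \<beta>2 + \<beta>1 * \<alpha>2" "c 2 = \<beta>1 * \<beta>2"
    using quadratic_factors nonneg disc by metis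
  have "c = linmul \<alpha>1 \<beta>1 (linmul \<alpha>2 \<beta>2 (\<lambda>k. if k = 0 then 1 else 0))"
  proof
    fix k :: nat
    consider "k = 0" | "k = 1" | "k = 2" | "k \<ge> 3" by linarith
    then show "c k = linmul \<alpha>1 \<beta>1 (linmul \<alpha>2 \<beta>2 (\<lambda>k. if k = 0 then 1 else 0)) k"
      using f zero by cases auto
  qed
  moreover have "\<dots> \<in> TP_inf"
    by (intro TP_inf_linear_factor unit_TP_inf f)
  ultimately show ?thesis by simp
qed

text \<open>The hypotheses on \<open>c\<close> express the factorization
  \<open>c 0 + c 1 x + c 2 x^2 + c 3 x^3 = (y + x) (e0 + e1 x + e2 x^2)\<close>.\<close>

lemma TP_inf_cubic:
  assumes e: "0 \<le> y" "0 \<le> e0" "0 \<le> e1" "0 \<le> e2" "4 * e0 * e2 \<le> e1\<^sup>2"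
    and c: "c 0 = y * e0" "c 1 = e0 + y * e1" "c 2 = e1 + y * e2" "c 3 = e2"
    and zero: "\<forall>k\<ge>4. c k = 0"
  shows "c \<in> TP_inf"
proof -
  define d :: "nat \<Rightarrow> real" where
    "d k = (if k = 0 then e0 else if k = 1 then e1 else if k = 2 then e2 else 0)" for k
  have "d \<in> TP_inf" by (rule TP_inf_quadratic) (use e in \<open>auto simp: d_def\<close>)
  then have "linmul y 1 d \<in> TP_inf" using e by (intro TP_inf_linear_factor) auto
  moreover have "linmul y 1 d = c"
  proof
    fix k :: nat
    consider "k = 0" | "k = 1" | "k = 2" | "k = 3" | "k \<ge> 4" by linarith
    then show "linmul y 1 d k = c k"
      using c zero by cases (auto simp: d_def)
  qed
  ultimately show ?thesis by simp
qed

section \<open>Hessenberg determinants of a Toeplitz matrix\<close>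

text \<open>The matrix has the entries \<open>c (1 + q - p)\<close>, with \<open>c\<close> extended by zero to negative indices, except
  that its row \<open>0\<close> is \<open>c r, c (r + 1), \<dots>\<close>. For \<open>r = 1\<close> it is the Toeplitz matrix with rows
  \<open>0, \<dots>, n - 1\<close> and columns \<open>1, \<dots>, n\<close>. The free parameter \<open>r\<close> lets the expansion along
  column \<open>0\<close> stay inside the family.\<close>

definition hess :: "(nat \<Rightarrow> real) \<Rightarrow> nat \<Rightarrow> nat \<Rightarrow> real" where
  "hess c n r = det (mat n n (\<lambda>(p, q). if p = 0 then c (r + q) else toeplitz c p (Suc q)))"

lemma hess_0 [simp]: "hess c 0 r = 1"
  by (simp add: hess_def)

lemma hess_1 [simp]: "hess c (Suc 0) r = c r"
  by (simp add: hess_def det_single)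

lemma hess_Suc:
  assumes "0 < n"
  shows "hess c (Suc n) r = c r * hess c n 1 - c 0 * hess c n (Suc r)"
proof -
  let ?A = "mat (Suc n) (Suc n) (\<lambda>(p, q). if p = 0 then c (r + q) else toeplitz c p (Suc q))"
  have "hess c (Suc n) r = (\<Sum>i<Suc n. ?A $$ (i, 0) * cofactor ?A i 0)"
    unfolding hess_def by (rule laplace_expansion_column) auto
  also have "\<dots> = (\<Sum>i\<in>{0, 1}. ?A $$ (i, 0) * cofactor ?A i 0)"
    by (rule sum.mono_neutral_right) (use assms in \<open>auto simp: toeplitz_def\<close>)
  also have "mat_delete ?A 0 0 =
      mat n n (\<lambda>(p, q). if p = 0 then c (1 + q) else toeplitz c p (Suc q))"
    by (rule eq_matI) (auto simp: mat_delete_def toeplitz_def)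
  then have "cofactor ?A 0 0 = hess c n 1" by (simp add: cofactor_def hess_def del: One_nat_def)
  moreover have "mat_delete ?A 1 0 =
      mat n n (\<lambda>(p, q). if p = 0 then c (Suc r + q) else toeplitz c p (Suc q))"
    by (rule eq_matI) (auto simp: mat_delete_def toeplitz_def)
  then have "cofactor ?A 1 0 = - hess c n (Suc r)" by (simp add: cofactor_def hess_def)
  ultimately show ?thesis using assms by (simp add: toeplitz_def)
qed

lemma hess_zero:
  assumes "0 < n" "\<forall>k\<ge>r. c k = 0"
  shows "hess c n r = 0"
  unfolding hess_def using assms by (intro det_zero_row[of 0]) auto

lemma hess_recurrence:
  assumes "\<forall>k\<ge>4. c k = 0"
  shows "hess c (n + 3) 1 = c 1 * hess c (n + 2) 1 - c 0 * c 2 * hess c (n + 1) 1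
    + (c 0)\<^sup>2 * c 3 * hess c n 1"
proof -
  have 3: "hess c (Suc n) 3 = c 3 * hess c n 1"
    by (cases n) (use assms in \<open>auto simp: hess_Suc hess_zero\<close>)
  show ?thesis
    using 3 by (simp add: hess_Suc eval_nat_numeral power2_eq_square algebra_simps)
qed

lemma hess_recurrence_quadratic:
  assumes "\<forall>k\<ge>3. c k = 0"
  shows "hess c (n + 2) 1 = c 1 * hess c (n + 1) 1 - c 0 * c 2 * hess c n 1"
proof -
  have "hess c (Suc n) 2 = c 2 * hess c n 1"
    by (cases n) (use assms in \<open>auto simp: hess_Suc hess_zero\<close>)
  then show ?thesis
    by (simp add: hess_Suc eval_nat_numeral)
qed

lemma hess_nonneg:
  assumes "c \<in> TP_inf"
  shows "0 \<le> hess c n 1"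
proof -
  have "hess c n 1 = minor (toeplitz c) n (\<lambda>p. p) Suc"
    unfolding hess_def minor_def
    by (rule arg_cong[where f = det], rule eq_matI) (auto simp: toeplitz_def)
  then show ?thesis
    using assms by (auto simp: TP_inf_def nonneg_minors_def strict_mono_on_def)
qed

lemma hess_nonneg_shift:
  assumes "(\<lambda>k. if k = 0 then 0 else c (k - 1)) \<in> TP_inf"
  shows "0 \<le> hess c n 1"
proof -
  have "hess c n 1 = minor (toeplitz (\<lambda>k. if k = 0 then 0 else c (k - 1))) n (\<lambda>p. p) (\<lambda>q. q + 2)"
    unfolding hess_def minor_def
    by (rule arg_cong[where f = det], rule eq_matI)
      (auto simp: toeplitz_def not_le Suc_diff_le)
  then show ?thesis
    using assms by (auto simp: TP_inf_def nonneg_minors_def strict_mono_on_def)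
qed

section \<open>Oscillating solutions of a linear recurrence\<close>

context
  fixes g :: "nat \<Rightarrow> real" and s :: real
  assumes rec: "\<And>n. g (n + 2) = s * g (n + 1) - g n" and s: "\<bar>s\<bar> < 2"
begin

text \<open>A conserved quadratic form, positive definite because of \<open>\<bar>s\<bar> < 2\<close>.\<close>

lemma oscillating_energy:
  "(g n)\<^sup>2 - s * g n * g (n + 1) + (g (n + 1))\<^sup>2 = (g 0)\<^sup>2 - s * g 0 * g 1 + (g 1)\<^sup>2"
proof (induction n)
  case (Suc n)
  have "(g (n + 1))\<^sup>2 - s * g (n + 1) * g (n + 2) + (g (n + 2))\<^sup>2 =
      (g n)\<^sup>2 - s * g n * g (n + 1) + (g (n + 1))\<^sup>2"
    unfolding rec by (simp add: power2_eq_square algebra_simps)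
  then show ?case using Suc by simp
qed simp

lemma oscillating_sum_bounded: "\<exists>B. \<forall>n. sum g {..<n} \<le> B"
proof -
  define E where "E = (g 0)\<^sup>2 - s * g 0 * g 1 + (g 1)\<^sup>2"
  have s2: "0 < 1 - s\<^sup>2 / 4"
    using s abs_square_less_1[of "s / 2"] by (simp add: power_divide)
  define G where "G = sqrt (E / (1 - s\<^sup>2 / 4))"
  have G: "\<bar>g n\<bar> \<le> G" for n
  proof -
    have "E = (1 - s\<^sup>2 / 4) * (g n)\<^sup>2 + (g (n + 1) - s / 2 * g n)\<^sup>2"
      unfolding E_def oscillating_energy[of n, symmetric]
      by (simp add: power2_eq_square field_simps)
    then have "(g n)\<^sup>2 \<le> E / (1 - s\<^sup>2 / 4)"
      using s2 by (simp add: field_simps)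
    then show ?thesis unfolding G_def by (metis real_sqrt_abs real_sqrt_le_iff)
  qed
  have tel: "(2 - s) * sum g {..<n} = g 0 + g 1 - s * g 0 + (s - 1) * g n - g (n + 1)" for n
  proof (induction n)
    case (Suc n)
    then show ?case using rec[of n] by (simp add: algebra_simps)
  qed (simp add: algebra_simps)
  have "sum g {..<n} \<le> (\<bar>g 0 + g 1 - s * g 0\<bar> + 4 * G) / (2 - s)" for n
  proof -
    have "\<bar>(s - 1) * g n\<bar> \<le> 3 * G"
      unfolding abs_mult using s G[of n] by (intro mult_mono) auto
    then have "(2 - s) * sum g {..<n} \<le> \<bar>g 0 + g 1 - s * g 0\<bar> + 4 * G"
      using G[of "n + 1"] unfolding tel by linarith
    then show ?thesis using s by (simp add: field_simps)
  qed
  then show ?thesis by blast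
qed

lemma oscillating_null:
  assumes "g \<longlonglongrightarrow> 0"
  shows "g 0 = 0 \<and> g 1 = 0"
proof -
  have "(\<lambda>n. (g n)\<^sup>2 - s * g n * g (n + 1) + (g (n + 1))\<^sup>2) \<longlonglongrightarrow> 0\<^sup>2 - s * 0 * 0 + 0\<^sup>2"
    by (intro tendsto_intros assms LIMSEQ_ignore_initial_segment)
  then have "(\<lambda>n::nat. (g 0)\<^sup>2 - s * g 0 * g 1 + (g 1)\<^sup>2) \<longlonglongrightarrow> 0"
    unfolding oscillating_energy by simp
  then have "(g 0)\<^sup>2 - s * g 0 * g 1 + (g 1)\<^sup>2 = 0"
    by (simp add: LIMSEQ_const_iff)
  then have "(1 - s\<^sup>2 / 4) * (g 0)\<^sup>2 + (g 1 - s / 2 * g 0)\<^sup>2 = 0"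
    by (simp add: power2_eq_square field_simps)
  moreover have "0 < 1 - s\<^sup>2 / 4"
    using s abs_square_less_1[of "s / 2"] by (simp add: power_divide)
  ultimately show ?thesis
    by (auto simp: add_nonneg_eq_0_iff)
qed

lemma oscillating_nonneg:
  assumes "\<And>n. 0 \<le> g n"
  shows "g 0 = 0 \<and> g 1 = 0"
proof -
  obtain B where "\<And>n. sum g {..<n} \<le> B"
    using oscillating_sum_bounded by blast
  then have "summable g"
    using assms by (intro summableI_nonneg_bounded)
  then show ?thesis by (intro oscillating_null summable_LIMSEQ_zero)
qed

text \<open>As in the nonnegative case, but for a nonnegative sequence that becomes oscillating after the
  real mode \<open>r ^ (-n)\<close> has been removed.\<close>

lemma oscillating_dominated:
  assumes w: "\<And>n. 0 \<le> w n" and g: "\<And>n. g n = r * w (n + 1) - w n" and r: "1 < r"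
  shows "g 0 = 0 \<and> g 1 = 0"
proof -
  obtain B where B: "\<And>n. sum g {..<n} \<le> B"
    using oscillating_sum_bounded by blast
  have "sum g {..<n} = (r - 1) * sum w {..<n} + r * (w n - w 0)" for n
    by (induction n) (auto simp: g algebra_simps)
  moreover have "0 \<le> r * w n" for n using w r by simp
  ultimately have "sum w {..<n} \<le> (B + r * w 0) / (r - 1)" for n
    using B[of n] r \<open>0 \<le> r * w n\<close> by (simp add: field_simps) (smt (verit))
  then have "summable w"
    using w by (intro summableI_nonneg_bounded)
  then have "w \<longlonglongrightarrow> 0" by (rule summable_LIMSEQ_zero)
  then have "(\<lambda>n. r * w (n + 1) - w n) \<longlonglongrightarrow> r * 0 - 0"
    by (intro tendsto_intros LIMSEQ_ignore_initial_segment)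
  then show ?thesis by (intro oscillating_null) (simp add: g[abs_def])
qed

end

section \<open>Total positivity excludes nonreal zeros\<close>

lemma quadratic_discriminant:
  assumes TP: "(\<lambda>k. if k = 0 then 0 else c (k - 1)) \<in> TP_inf" and zero: "\<forall>k\<ge>3. c k = 0"
    and pos: "0 < c 0" "0 < c 1" "0 < c 2"
  shows "4 * c 0 * c 2 \<le> (c 1)\<^sup>2"
proof (rule ccontr)
  assume "\<not> ?thesis"
  then have neg: "(c 1)\<^sup>2 < 4 * c 0 * c 2" by simp
  define \<tau> where "\<tau> = sqrt (c 0 * c 2)"
  have \<tau>: "0 < \<tau>" "\<tau>\<^sup>2 = c 0 * c 2" using pos by (simp_all add: \<tau>_def)
  define w where "w n = hess c n 1 / \<tau> ^ n" for n
  have "w (n + 2) = c 1 / \<tau> * w (n + 1) - w n" for n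
    using \<tau>(1) unfolding w_def hess_recurrence_quadratic[OF zero] \<tau>(2)[symmetric]
    by (simp add: field_simps power2_eq_square)
  moreover have "c 1 < 2 * \<tau>"
    by (rule power2_less_imp_less) (use neg \<tau> in \<open>auto simp: power_mult_distrib\<close>)
  then have "\<bar>c 1 / \<tau>\<bar> < 2"
    using pos \<tau> by (simp add: field_simps)
  moreover have "0 \<le> w n" for n
    using hess_nonneg_shift[OF TP] \<tau> by (simp add: w_def)
  ultimately have "w 0 = 0" by (rule oscillating_nonneg[THEN conjunct1])
  then show False by (simp add: w_def)
qed

text \<open>The hypotheses on \<open>c\<close> express the factorization
  \<open>\<Sum> c k x^k = \<kappa> (x + r \<tau>) (x^2 + s \<tau> x + \<tau>^2)\<close>. If \<open>\<bar>s\<bar> < 2\<close> then the quadratic factor has a pair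
  of nonreal zeros, of modulus \<open>\<tau>\<close> smaller than that of the real zero, and this pair dominates the
  growth of the Hessenberg determinants.\<close>

lemma cubic_dominant_complex_pair:
  assumes TP: "c \<in> TP_inf" and zero: "\<forall>k\<ge>4. c k = 0"
    and c: "c 0 = \<kappa> * r * \<tau> ^ 3" "c 1 = \<kappa> * \<tau>\<^sup>2 * (r * s + 1)"
      "c 2 = \<kappa> * \<tau> * (r + s)" "c 3 = \<kappa>"
    and pos: "0 < \<kappa>" "0 < \<tau>" "1 < r"
  shows "2 \<le> \<bar>s\<bar>"
proof (rule ccontr)
  assume "\<not> ?thesis"
  then have s: "\<bar>s\<bar> < 2" by simp
  \<comment> \<open>Since \<open>d = c 0 / \<tau>\<close>, dividing by \<open>d ^ n\<close> moves the characteristic roots that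
    belong to the nonreal zeros to the unit circle.\<close>
  define d where "d = \<kappa> * r * \<tau>\<^sup>2"
  have d: "0 < d" using pos by (simp add: d_def)
  define w where "w n = hess c n 1 / d ^ n" for n
  have H: "hess c n 1 = d ^ n * w n" for n
    using d by (simp add: w_def)
  \<comment> \<open>This combination removes the mode of \<open>w\<close> that belongs to the real zero.\<close>
  define g where "g n = r * w (n + 1) - w n" for n
  have rec: "g (n + 2) = s * g (n + 1) - g n" for n
  proof -
    have "d ^ n * (\<kappa> ^ 3 * r\<^sup>2 * \<tau> ^ 6) * (r * w (n + 3)) = d ^ n * (\<kappa> ^ 3 * r\<^sup>2 * \<tau> ^ 6) *
        ((r * s + 1) * w (n + 2) - (r + s) * w (n + 1) + w n)"
      using hess_recurrence[OF zero, of n] unfolding H c power_add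
      by (simp add: d_def power_mult_distrib eval_nat_numeral algebra_simps)
    then have "r * w (n + 3) = (r * s + 1) * w (n + 2) - (r + s) * w (n + 1) + w n"
      using d pos by simp
    then show ?thesis by (simp add: g_def eval_nat_numeral algebra_simps)
  qed
  have "0 \<le> w n" for n
    using hess_nonneg[OF TP] d by (simp add: w_def)
  then have "g 0 = 0 \<and> g 1 = 0"
    using rec s pos
    by (intro oscillating_dominated[where w = w and r = r and g = g]) (auto simp: g_def)
  then have g: "g 0 = 0" "g 1 = 0" by auto
  \<comment> \<open>The first three values of \<open>w\<close> are incompatible with \<open>g = 0\<close>.\<close>
  have w0: "w 0 = 1" by (simp add: w_def)
  have w1: "r * w 1 = r * s + 1"
  proof -
    have "w 1 = c 1 / d" by (simp add: w_def)
    show ?thesis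
      unfolding \<open>w 1 = c 1 / d\<close> c d_def using pos by (simp add: field_simps power2_eq_square)
  qed
  have "s = 0" using g(1) w0 w1 pos by (simp add: g_def)
  have "r * w 1 = 1" using w1 \<open>s = 0\<close> by simp
  have w2: "w 2 = (w 1)\<^sup>2 - 1"
  proof -
    have "w 2 = (c 1 * c 1 - c 0 * c 2) / d\<^sup>2"
      by (simp add: w_def hess_Suc eval_nat_numeral)
    moreover have "w 1 = c 1 / d" by (simp add: w_def)
    ultimately have "w 2 = (w 1)\<^sup>2 - c 0 * c 2 / d\<^sup>2"
      by (simp add: diff_divide_distrib power2_eq_square)
    also have "c 0 * c 2 / d\<^sup>2 = 1"
      unfolding c d_def using pos \<open>s = 0\<close>
      by (simp add: field_simps power2_eq_square power3_eq_cube)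
    finally show ?thesis .
  qed
  have "r * w 2 = w 1" using g(2) by (simp add: g_def numeral_2_eq_2)
  then have "r * (r * w 2) = 1" using \<open>r * w 1 = 1\<close> by simp
  moreover have "r * (r * w 2) = (r * w 1)\<^sup>2 - r\<^sup>2"
    unfolding w2 by (simp add: power2_eq_square algebra_simps)
  ultimately show False using \<open>r * w 1 = 1\<close> pos by simp
qed

lemma poly_map_sum_monom:
  "poly (map_poly complex_of_real (\<Sum>k=m..n. monom (a k) k)) z = (\<Sum>k=m..n. a k * z ^ k)"
proof -
  have "map_poly complex_of_real (\<Sum>k=m..n. monom (a k) k) =
      (\<Sum>k=m..n. monom (complex_of_real (a k)) k)"
    by (rule poly_eqI) (simp add: coeff_map_poly coeff_sum)
  then show ?thesis by (simp add: poly_sum poly_monom)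
qed

lemma poly_cubic:
  "poly (map_poly complex_of_real (\<Sum>k=0..3. monom (a k) k)) z =
    a 0 + a 1 * z + a 2 * z\<^sup>2 + a 3 * z ^ 3"
  unfolding poly_map_sum_monom by (simp add: eval_nat_numeral)

lemma poly_cubic_tail:
  "poly (map_poly complex_of_real (\<Sum>k=1..3. monom (a k) k)) z =
    a 1 * z + a 2 * z\<^sup>2 + a 3 * z ^ 3"
  unfolding poly_map_sum_monom by (simp add: eval_nat_numeral)

lemma TP_inf_cubic_zeros_real:
  fixes a :: "nat \<Rightarrow> real" and z :: complex
  assumes TP: "a \<in> TP_inf" and zero: "\<forall>k\<ge>4. a k = 0" and pos: "\<forall>k\<le>3. 0 < a k"
    and disc: "4 * a 1 * a 3 \<le> (a 2)\<^sup>2"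
    and z: "a 0 + a 1 * z + a 2 * z\<^sup>2 + a 3 * z ^ 3 = 0"
  shows "z \<in> \<real>"
proof (rule ccontr)
  assume "z \<notin> \<real>"
  define x y where "x = Re z" and "y = Im z"
  have y: "y \<noteq> 0" using \<open>z \<notin> \<real>\<close> by (simp add: y_def complex_is_Real_iff)
  have a: "0 < a 0" "0 < a 1" "0 < a 2" "0 < a 3" using pos by auto
  have zxy: "z = Complex x y" by (simp add: x_def y_def)
  have "a 0 + a 1 * x + a 2 * (x\<^sup>2 - y\<^sup>2) + a 3 * (x ^ 3 - 3 * x * y\<^sup>2) = 0"
    using arg_cong[OF z, of Re] unfolding zxy
    by (simp add: power2_eq_square power3_eq_cube algebra_simps)
  moreover have "y * (a 1 + 2 * a 2 * x + a 3 * (3 * x\<^sup>2 - y\<^sup>2)) = 0"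
    using arg_cong[OF z, of Im] unfolding zxy
    by (simp add: power2_eq_square power3_eq_cube algebra_simps)
  ultimately have re: "a 0 + a 1 * x + a 2 * (x\<^sup>2 - y\<^sup>2) + a 3 * (x ^ 3 - 3 * x * y\<^sup>2) = 0"
    and im: "a 1 + 2 * a 2 * x + a 3 * (3 * x\<^sup>2 - y\<^sup>2) = 0"
    using y by auto
  \<comment> \<open>The cubic is \<open>a 3 (X + \<rho>) (X^2 - 2 x X + \<tau>^2)\<close>.\<close>
  define \<tau> where "\<tau> = sqrt (x\<^sup>2 + y\<^sup>2)"
  have t0: "0 < x\<^sup>2 + y\<^sup>2" using y by (simp add: sum_power2_gt_zero_iff)
  have \<tau>: "0 < \<tau>" "\<tau>\<^sup>2 = x\<^sup>2 + y\<^sup>2" using t0 by (simp_all add: \<tau>_def)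
  define \<rho> where "\<rho> = a 2 / a 3 + 2 * x"
  have a2: "a 2 = a 3 * (\<rho> - 2 * x)" using a by (simp add: \<rho>_def)
  have a1: "a 1 = a 3 * (\<tau>\<^sup>2 - 2 * x * \<rho>)"
    using im unfolding a2 \<tau> by (simp add: algebra_simps power2_eq_square)
  have a0: "a 0 = a 3 * \<rho> * \<tau>\<^sup>2"
    using re unfolding a1 a2 \<tau> by (simp add: algebra_simps power2_eq_square power3_eq_cube)
  have \<rho>: "0 < \<rho>" using a0 a \<tau> by (metis zero_less_mult_pos zero_less_mult_pos2 zero_less_power)
  have "0 < \<rho> - 2 * x" using a2 a by (metis zero_less_mult_pos)
  have "\<bar>x\<bar> < \<tau>"
    by (rule power2_less_imp_less) (use \<tau> y in auto)
  have "(2 * \<tau>)\<^sup>2 \<le> (\<rho> + 2 * x)\<^sup>2"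
  proof -
    have "4 * (\<tau>\<^sup>2 - 2 * x * \<rho>) * (a 3)\<^sup>2 \<le> (\<rho> - 2 * x)\<^sup>2 * (a 3)\<^sup>2"
      using disc unfolding a1 a2 by (simp add: power2_eq_square algebra_simps)
    then have "4 * (\<tau>\<^sup>2 - 2 * x * \<rho>) \<le> (\<rho> - 2 * x)\<^sup>2" using a by simp
    then show ?thesis by (simp add: power2_eq_square algebra_simps)
  qed
  then have "2 * \<tau> \<le> \<bar>\<rho> + 2 * x\<bar>"
    using \<tau> by (metis abs_le_square_iff abs_of_pos mult_pos_pos zero_less_numeral)
  then have "\<tau> < \<rho>"
    using \<open>0 < \<rho> - 2 * x\<close> \<open>\<bar>x\<bar> < \<tau>\<close> \<rho> by linarith
  have "2 \<le> \<bar>- 2 * x / \<tau>\<bar>"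
  proof (rule cubic_dominant_complex_pair[OF TP zero, of "a 3" "\<rho> / \<tau>" \<tau>])
    show "a 0 = a 3 * (\<rho> / \<tau>) * \<tau> ^ 3"
      unfolding a0 using \<tau>(1) by (simp add: power2_eq_square power3_eq_cube)
    show "a 1 = a 3 * \<tau>\<^sup>2 * (\<rho> / \<tau> * (- 2 * x / \<tau>) + 1)"
      unfolding a1 using \<tau>(1) by (simp add: field_simps power2_eq_square)
    show "a 2 = a 3 * \<tau> * (\<rho> / \<tau> + - 2 * x / \<tau>)"
      unfolding a2 using \<tau>(1) by (simp add: field_simps)
  qed (use \<tau>(1) \<open>\<tau> < \<rho>\<close> a in auto)
  then show False using \<open>\<bar>x\<bar> < \<tau>\<close> \<tau> by (simp add: abs_mult field_simps)
qed

lemma preserves_imp_zeros: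
  fixes a :: "nat \<Rightarrow> real"
  assumes pos: "\<forall>k\<le>3. 0 < a k" and zero: "\<forall>k\<ge>4. a k = 0"
    and pres: "\<forall>b\<in>TP_inf. Lam a b \<in> TP_inf"
  shows "only_real_nonpos_zeros (\<Sum>k=0..3. monom (a k) k)"
    "only_real_nonpos_zeros (\<Sum>k=1..3. monom (a k) k)"
proof -
  have a: "0 < a 0" "0 < a 1" "0 < a 2" "0 < a 3" using pos by auto
  have "Lam a (\<lambda>k. 1) \<in> TP_inf" using pres ones_TP_inf by blast
  then have TP: "a \<in> TP_inf" by (simp add: Lam_def)
  have "Lam a (\<lambda>k. if k = 0 then 0 else 1) \<in> TP_inf" using pres shifted_ones_TP_inf by blast
  also have "Lam a (\<lambda>k. if k = 0 then 0 else 1) = (\<lambda>k. if k = 0 then 0 else a (Suc (k - 1)))"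
    by (auto simp: Lam_def)
  finally have "4 * a (Suc 0) * a (Suc 2) \<le> (a (Suc 1))\<^sup>2"
    by (rule quadratic_discriminant) (use pos zero in auto)
  then have disc: "4 * a 1 * a 3 \<le> (a 2)\<^sup>2" by (simp add: eval_nat_numeral)
  have real_nonpos: "x \<le> 0" if "e + a 1 * x + a 2 * x\<^sup>2 + a 3 * x ^ 3 = 0" "0 \<le> e" for x e :: real
  proof (rule ccontr)
    assume "\<not> x \<le> 0"
    then have "0 < a 1 * x" "0 < a 2 * x\<^sup>2" "0 < a 3 * x ^ 3" using a by auto
    then show False using that by linarith
  qed
  show "only_real_nonpos_zeros (\<Sum>k=0..3. monom (a k) k)"
    unfolding only_real_nonpos_zeros_def poly_cubic
  proof (intro allI impI)
    fix z :: complex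
    assume z: "a 0 + a 1 * z + a 2 * z\<^sup>2 + a 3 * z ^ 3 = 0"
    then have "z \<in> \<real>" by (rule TP_inf_cubic_zeros_real[OF TP zero pos disc])
    then obtain x where x: "z = complex_of_real x" by (auto elim: Reals_cases)
    have "complex_of_real (a 0 + a 1 * x + a 2 * x\<^sup>2 + a 3 * x ^ 3) = 0"
      using z unfolding x by simp
    then have "a 0 + a 1 * x + a 2 * x\<^sup>2 + a 3 * x ^ 3 = 0" by (simp only: of_real_eq_0_iff)
    then show "z \<in> \<real> \<and> Re z \<le> 0" using real_nonpos[of "a 0" x] a \<open>z \<in> \<real>\<close> x by simp
  qed
  show "only_real_nonpos_zeros (\<Sum>k=1..3. monom (a k) k)"
    unfolding only_real_nonpos_zeros_def poly_cubic_tail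
  proof (intro allI impI)
    fix z :: complex
    assume z: "a 1 * z + a 2 * z\<^sup>2 + a 3 * z ^ 3 = 0"
    have "z \<in> \<real>"
    proof (cases "z = 0")
      case False
      define x y where "x = Re z" and "y = Im z"
      have zxy: "z = Complex x y" by (simp add: x_def y_def)
      have "z * (a 1 + a 2 * z + a 3 * z\<^sup>2) = 0"
        using z by (simp add: algebra_simps power2_eq_square power3_eq_cube)
      then have q: "a 1 + a 2 * z + a 3 * z\<^sup>2 = 0" using False by simp
      have re: "a 1 + a 2 * x + a 3 * (x\<^sup>2 - y\<^sup>2) = 0"
        using arg_cong[OF q, of Re] unfolding zxy by (simp add: power2_eq_square algebra_simps)
      have im: "y * (a 2 + 2 * a 3 * x) = 0"
        using arg_cong[OF q, of Im] unfolding zxy by (simp add: power2_eq_square algebra_simps)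
      have "y = 0"
      proof (rule ccontr)
        assume "y \<noteq> 0"
        then have "a 2 = - 2 * a 3 * x" using im by simp
        then have "a 3 * (a 1 - a 3 * x\<^sup>2 - a 3 * y\<^sup>2) = 0" "a 3 * (a 1 - a 3 * x\<^sup>2) \<le> 0"
          using re disc by (simp_all add: power2_eq_square algebra_simps)
        moreover have "0 < a 3 * (a 3 * y\<^sup>2)" using a \<open>y \<noteq> 0\<close> by simp
        ultimately show False by (simp add: algebra_simps)
      qed
      then show ?thesis by (simp add: complex_is_Real_iff y_def)
    qed simp
    then obtain x where x: "z = complex_of_real x" by (auto elim: Reals_cases)
    have "complex_of_real (a 1 * x + a 2 * x\<^sup>2 + a 3 * x ^ 3) = 0"
      using z unfolding x by simp
    then have "a 1 * x + a 2 * x\<^sup>2 + a 3 * x ^ 3 = 0" by (simp only: of_real_eq_0_iff)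
    then show "z \<in> \<real> \<and> Re z \<le> 0" using real_nonpos[of 0 x] \<open>z \<in> \<real>\<close> x by simp
  qed
qed

section \<open>Sign changes of a cubic with real zeros\<close>

lemma real_quadratic_nonreal_zero:
  fixes p q r :: real
  assumes "q\<^sup>2 < 4 * p * r" "r \<noteq> 0"
  obtains z :: complex where "p + q * z + r * z\<^sup>2 = 0" "z \<notin> \<real>"
proof (rule that)
  define d where "d = sqrt (4 * p * r - q\<^sup>2)"
  have d: "0 < d" "d\<^sup>2 = 4 * p * r - q\<^sup>2" using assms by (simp_all add: d_def)
  define x y where "x = - q / (2 * r)" and "y = d / (2 * r)"
  have q: "q = - 2 * r * x" and dy: "d = 2 * r * y"
    using assms(2) by (simp_all add: x_def y_def)
  have "4 * r * p = 4 * r * (r * (x\<^sup>2 + y\<^sup>2))"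
    using d(2) unfolding q dy by (simp add: power2_eq_square algebra_simps)
  then have p: "p = r * (x\<^sup>2 + y\<^sup>2)" using assms(2) by simp
  show "Complex x y \<notin> \<real>" using d assms by (simp add: complex_is_Real_iff y_def)
  show "p + q * Complex x y + r * (Complex x y)\<^sup>2 = 0"
    unfolding p q by (simp add: complex_eq_iff power2_eq_square algebra_simps)
qed

text \<open>The zeros of \<open>a 0 - a 1 x + a 2 x^2 - a 3 x^3\<close> are positive with sum \<open>a 2 / a 3\<close>. Once one of
  them is set aside, the smaller one of the other two is less than half of this sum.\<close>

lemma zeros_imp_sign:
  fixes a :: "nat \<Rightarrow> real"
  assumes pos: "\<forall>k\<le>3. 0 < a k"
    and zeros: "only_real_nonpos_zeros (\<Sum>k=0..3. monom (a k) k)"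
  obtains v where "0 < v" "2 * a 3 * v < a 2" "a 0 - a 1 * v + a 2 * v\<^sup>2 - a 3 * v ^ 3 \<le> 0"
proof -
  have a: "0 < a 0" "0 < a 1" "0 < a 2" "0 < a 3" using pos by auto
  let ?f = "\<lambda>y. a 0 - a 1 * y + a 2 * y\<^sup>2 - a 3 * y ^ 3"
  \<comment> \<open>At this point the cubic term outweighs the two positive ones.\<close>
  define M where "M = 1 + (a 0 + a 2) / a 3"
  have M: "1 \<le> M" using a by (simp add: M_def)
  have "a 3 * M = a 3 + a 0 + a 2" using a by (simp add: M_def field_simps)
  then have "?f M = a 0 - a 1 * M - M\<^sup>2 * (a 0 + a 3)"
    by (simp add: power2_eq_square power3_eq_cube algebra_simps)
  moreover have "a 0 + a 3 \<le> M\<^sup>2 * (a 0 + a 3)"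
    using M a by (simp add: one_le_power)
  moreover have "0 \<le> a 1 * M" using M a by simp
  ultimately have "?f M \<le> 0" using a by linarith
  then obtain y where y: "0 \<le> y" "?f y = 0"
    using IVT2[of ?f M 0 0] M a by (auto intro!: continuous_intros)
  have "y \<noteq> 0" using y a by auto
  then have "0 < y" using y by simp
  define e where "e = a 2 - a 3 * y"
  define g where "g = a 1 - e * y"
  have a0: "a 0 = y * g"
    using y(2) by (simp add: g_def e_def algebra_simps power2_eq_square power3_eq_cube)
  have disc: "4 * g * a 3 \<le> e\<^sup>2"
  proof (rule ccontr)
    assume "\<not> ?thesis"
    then obtain z :: complex where z: "g + e * z + a 3 * z\<^sup>2 = 0" "z \<notin> \<real>"
      using real_quadratic_nonreal_zero[of e g "a 3"] a by auto
    have "a 0 + a 1 * z + a 2 * z\<^sup>2 + a 3 * z ^ 3 = (y + z) * (g + e * z + a 3 * z\<^sup>2)"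
      unfolding a0 by (simp add: g_def e_def algebra_simps power2_eq_square power3_eq_cube)
    then have "a 0 + a 1 * z + a 2 * z\<^sup>2 + a 3 * z ^ 3 = 0" using z by simp
    then show False
      using zeros z unfolding only_real_nonpos_zeros_def poly_cubic by blast
  qed
  \<comment> \<open>The zeros other than \<open>y\<close> are the roots of \<open>g - e x + a 3 x^2\<close>; \<open>v\<close> is the smaller one.\<close>
  define d where "d = sqrt (e\<^sup>2 - 4 * g * a 3)"
  have d: "0 \<le> d" "d\<^sup>2 = e\<^sup>2 - 4 * g * a 3" using disc by (simp_all add: d_def)
  define v where "v = (e - d) / (2 * a 3)"
  have "4 * a 3 * (g - e * v + a 3 * v\<^sup>2) = (2 * a 3 * v - e)\<^sup>2 - (e\<^sup>2 - 4 * g * a 3)"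
    by (simp add: algebra_simps power2_eq_square)
  also have "2 * a 3 * v - e = - d" using a by (simp add: v_def)
  finally have "g - e * v + a 3 * v\<^sup>2 = 0" using a d(2) by simp
  moreover have "?f v = (y - v) * (g - e * v + a 3 * v\<^sup>2)"
    unfolding a0 by (simp add: g_def e_def algebra_simps power2_eq_square power3_eq_cube)
  ultimately have fv: "?f v = 0" by simp
  have "0 < v"
  proof (rule ccontr)
    assume "\<not> 0 < v"
    then have "a 1 * v \<le> 0" "0 \<le> a 2 * v\<^sup>2" "a 3 * v ^ 3 \<le> 0"
      using a by (auto simp: mult_le_0_iff power3_eq_cube zero_le_mult_iff)
    then show False using fv a by linarith
  qed
  moreover have "2 * a 3 * v = e - d" using a by (simp add: v_def)
  then have "2 * a 3 * v < a 2"
    using d a \<open>0 < y\<close> mult_pos_pos[of "a 3" y] unfolding e_def by linarith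
  ultimately show ?thesis using that fv by simp
qed

lemma zeros_imp_discriminant:
  fixes a :: "nat \<Rightarrow> real"
  assumes "a 3 \<noteq> 0" and zeros: "only_real_nonpos_zeros (\<Sum>k=1..3. monom (a k) k)"
  shows "4 * a 1 * a 3 \<le> (a 2)\<^sup>2"
proof (rule ccontr)
  assume "\<not> ?thesis"
  then obtain z :: complex where z: "a 1 + a 2 * z + a 3 * z\<^sup>2 = 0" "z \<notin> \<real>"
    using real_quadratic_nonreal_zero[of "a 2" "a 1" "a 3"] assms by auto
  have "a 1 * z + a 2 * z\<^sup>2 + a 3 * z ^ 3 = z * (a 1 + a 2 * z + a 3 * z\<^sup>2)"
    by (simp add: algebra_simps power2_eq_square power3_eq_cube)
  then have "a 1 * z + a 2 * z\<^sup>2 + a 3 * z ^ 3 = 0" using z by simp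
  then show False
    using zeros z unfolding only_real_nonpos_zeros_def poly_cubic_tail by blast
qed

text \<open>The discriminant hypothesis makes \<open>c 0 - c 1 y + c 2 y^2 - c 3 y^3\<close> positive at
  \<open>y = c 2 / (2 * c 3)\<close>. Together with the value at \<open>u\<close>, this gives three sign
  changes on the positive half-line (in the weak sense at \<open>u\<close>).\<close>

lemma TP_inf_cubic_sign:
  assumes pos: "\<forall>k\<le>3. 0 < c k" and zero: "\<forall>k\<ge>4. c k = 0"
    and disc: "4 * c 1 * c 3 \<le> (c 2)\<^sup>2"
    and u: "0 < u" "2 * c 3 * u < c 2" "c 0 - c 1 * u + c 2 * u\<^sup>2 - c 3 * u ^ 3 \<le> 0"
  shows "c \<in> TP_inf"
proof -
  have c: "0 < c 0" "0 < c 1" "0 < c 2" "0 < c 3" using pos by auto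
  let ?f = "\<lambda>y. c 0 - c 1 * y + c 2 * y\<^sup>2 - c 3 * y ^ 3"
  obtain y where y: "0 \<le> y" "y \<le> u" "?f y = 0"
    using IVT2[of ?f u 0 0] u c by (auto intro!: continuous_intros)
  have "y \<noteq> 0" using y c by auto
  then have "0 < y" using y by simp
  define e1 where "e1 = c 2 - c 3 * y"
  define e0 where "e0 = c 0 / y"
  have c0: "c 0 = y * e0" using \<open>0 < y\<close> by (simp add: e0_def)
  have "y * (e0 - (c 1 - c 2 * y + c 3 * y\<^sup>2)) = 0"
    using y(3) unfolding c0 by (simp add: algebra_simps power2_eq_square power3_eq_cube)
  then have "e0 = c 1 - c 2 * y + c 3 * y\<^sup>2"
    using \<open>0 < y\<close> by simp
  then have c1: "c 1 = e0 + y * e1"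
    by (simp add: e1_def algebra_simps power2_eq_square)
  have "2 * (c 3 * y) < c 2"
    using mult_left_mono[OF y(2), of "c 3"] c u(2) by linarith
  moreover have "0 < c 3 * y" using c \<open>0 < y\<close> by simp
  ultimately have e1: "0 < e1" unfolding e1_def by linarith
  \<comment> \<open>The cubic \<open>?f\<close> is positive at \<open>Y > y\<close>, so its quadratic cofactor is negative there.\<close>
  define Y where "Y = c 2 / (2 * c 3)"
  have Y: "y < Y" using \<open>2 * (c 3 * y) < c 2\<close> c by (simp add: Y_def field_simps)
  have "c 1 - c 2 * Y + c 3 * Y\<^sup>2 \<le> 0"
    using disc c by (simp add: Y_def field_simps power2_eq_square)
  then have "Y * (c 1 - c 2 * Y + c 3 * Y\<^sup>2) \<le> 0"
    using Y \<open>0 < y\<close> by (simp add: mult_nonneg_nonpos)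
  then have "0 < ?f Y"
    using c by (simp add: algebra_simps power2_eq_square power3_eq_cube)
  also have "?f Y = (y - Y) * (c 3 * Y\<^sup>2 - e1 * Y + e0)"
    unfolding c0 c1 by (simp add: e1_def algebra_simps power2_eq_square power3_eq_cube)
  finally have "c 3 * Y\<^sup>2 - e1 * Y + e0 < 0"
    using Y by (simp add: zero_less_mult_iff)
  then have "4 * c 3 * (c 3 * Y\<^sup>2 - e1 * Y + e0) < 0"
    using c by (simp add: mult_pos_neg)
  moreover have "4 * c 3 * (c 3 * Y\<^sup>2 - e1 * Y + e0) =
      (2 * c 3 * Y - e1)\<^sup>2 - (e1\<^sup>2 - 4 * e0 * c 3)"
    by (simp add: algebra_simps power2_eq_square)
  moreover have "0 \<le> (2 * c 3 * Y - e1)\<^sup>2" by simp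
  ultimately have "4 * e0 * c 3 \<le> e1\<^sup>2" by linarith
  moreover have "0 \<le> e0" using c \<open>0 < y\<close> by (simp add: e0_def)
  moreover have "c 2 = e1 + y * c 3" by (simp add: e1_def)
  ultimately show ?thesis
    using \<open>0 < y\<close> e1 c c0 c1 zero by (intro TP_inf_cubic[of y e0 e1 "c 3" c]) auto
qed

section \<open>Sequences with nonnegative minors up to order three\<close>

lemma TP_minor_nonneg:
  "c \<in> TP m \<Longrightarrow> r \<le> m \<Longrightarrow> strict_mono_on {..<r} f \<Longrightarrow> strict_mono_on {..<r} g \<Longrightarrow>
    0 \<le> minor (toeplitz c) r f g"
  by (auto simp: TP_def nonneg_minors_def)

lemma TP_nonneg:
  assumes "b \<in> TP 3" shows "0 \<le> b k"
proof -
  have "0 \<le> minor (toeplitz b) 1 (\<lambda>p. p) (\<lambda>q. q + k)"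
    using assms by (intro TP_minor_nonneg[of _ 3]) (auto simp: strict_mono_on_def)
  then show ?thesis by (simp add: minor_def det_single toeplitz_def)
qed

lemma TP_minor_2:
  assumes "b \<in> TP 3" "i < i'" "j < j'"
  shows "toeplitz b i j' * toeplitz b i' j \<le> toeplitz b i j * toeplitz b i' j'"
proof -
  have "0 \<le> minor (toeplitz b) 2 (\<lambda>p. if p = 0 then i else i') (\<lambda>q. if q = 0 then j else j')"
    using assms by (intro TP_minor_nonneg[of _ 3]) (auto simp: strict_mono_on_def)
  then show ?thesis by (simp add: minor_def det_mat_2)
qed

lemma TP_minor_3:
  assumes "b \<in> TP 3"
  shows "0 \<le> b 1 ^ 3 - 2 * b 0 * b 1 * b 2 + (b 0)\<^sup>2 * b 3"
proof -
  have "hess b 3 1 = minor (toeplitz b) 3 (\<lambda>p. p) Suc"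
    unfolding hess_def minor_def
    by (rule arg_cong[where f = det], rule eq_matI) (auto simp: toeplitz_def)
  also have "0 \<le> \<dots>"
    using assms by (intro TP_minor_nonneg[of _ 3]) (auto simp: strict_mono_on_def)
  finally have "0 \<le> hess b 3 1" .
  then show ?thesis
    by (simp add: hess_Suc eval_nat_numeral algebra_simps)
qed

lemma zeros_imp_preserves:
  fixes a :: "nat \<Rightarrow> real"
  assumes pos: "\<forall>k\<le>3. 0 < a k" and zero: "\<forall>k\<ge>4. a k = 0"
    and zeros: "only_real_nonpos_zeros (\<Sum>k=0..3. monom (a k) k)"
      "only_real_nonpos_zeros (\<Sum>k=1..3. monom (a k) k)"
    and b: "b \<in> TP 3"
  shows "Lam a b \<in> TP_inf"
proof -
  have a: "0 < a 0" "0 < a 1" "0 < a 2" "0 < a 3" using pos by auto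
  define c where "c = Lam a b"
  have c: "c k = a k * b k" for k by (simp add: c_def Lam_def)
  have b0: "0 \<le> b k" for k by (rule TP_nonneg[OF b])
  have c0: "0 \<le> c k" for k
    using b0 pos zero by (cases "k \<le> 3") (auto simp: c less_imp_le)
  have czero: "\<forall>k\<ge>4. c k = 0" using zero by (simp add: c)
  have b012: "b 2 * b 0 \<le> b 1 * b 1" and b123: "b 3 * b 1 \<le> b 2 * b 2"
    and b0123: "b 3 * b 0 \<le> b 1 * b 2"
    using TP_minor_2[OF b, of 0 1 1 2] TP_minor_2[OF b, of 0 1 2 3] TP_minor_2[OF b, of 0 1 1 3]
    by (simp_all add: toeplitz_def)
  have da: "4 * a 1 * a 3 \<le> (a 2)\<^sup>2"
    using a zeros(2) by (intro zeros_imp_discriminant) auto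
  have disc: "4 * c 1 * c 3 \<le> (c 2)\<^sup>2"
  proof -
    have "4 * a 1 * a 3 * (b 3 * b 1) \<le> (a 2)\<^sup>2 * (b 2 * b 2)"
      by (rule mult_mono[OF da b123]) (use a b0 in auto)
    then show ?thesis by (simp add: c power2_eq_square algebra_simps)
  qed
  show ?thesis
    unfolding c_def[symmetric]
  proof (cases "b 0 = 0 \<or> b 1 = 0")
    case True
    show "c \<in> TP_inf"
    proof (cases "b 0 = 0")
      case True
      show ?thesis
        by (rule TP_inf_cubic[of 0 "c 1" "c 2" "c 3"]) (use True c0 disc czero in \<open>auto simp: c\<close>)
    next
      case False
      then have "b 1 = 0" "0 < b 0" using True b0[of 0] by auto
      then have "b 2 = 0" "b 3 = 0"
        using b012 b0123 b0[of 2] b0[of 3] by (auto simp: mult_le_0_iff)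
      have "c k = 0" if "k \<ge> 3" for k
        using czero that \<open>b 3 = 0\<close> by (cases "k = 3") (auto simp: c)
      then show ?thesis
        by (intro TP_inf_quadratic) (use c0 \<open>b 2 = 0\<close> in \<open>auto simp: c\<close>)
    qed
  next
    case False
    then have b01: "0 < b 0" "0 < b 1" using b0[of 0] b0[of 1] by auto
    obtain v where v: "0 < v" "2 * a 3 * v < a 2" "a 0 - a 1 * v + a 2 * v\<^sup>2 - a 3 * v ^ 3 \<le> 0"
      using zeros_imp_sign[OF pos zeros(1)] .
    define \<mu> where "\<mu> = b 0 * b 2 / (b 1)\<^sup>2"
    define \<nu> where "\<nu> = (b 0)\<^sup>2 * b 3 / b 1 ^ 3"
    have \<mu>: "\<mu> \<le> 1" using b012 b01 by (simp add: \<mu>_def field_simps power2_eq_square)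
    have \<nu>: "2 * \<mu> - 1 \<le> \<nu>"
    proof -
      have "\<nu> - (2 * \<mu> - 1) = (b 1 ^ 3 - 2 * b 0 * b 1 * b 2 + (b 0)\<^sup>2 * b 3) / b 1 ^ 3"
        using b01 by (simp add: \<mu>_def \<nu>_def field_simps power2_eq_square power3_eq_cube)
      also have "0 \<le> \<dots>" using TP_minor_3[OF b] b01 by simp
      finally show ?thesis by simp
    qed
    define u where "u = v * b 0 / b 1"
    have u: "0 < u" using v b01 by (simp add: u_def)
    \<comment> \<open>Rescaling by \<open>b 0 / b 1\<close> normalizes the first two coefficients of \<open>b\<close>.\<close>
    have fu: "c 0 - c 1 * u + c 2 * u\<^sup>2 - c 3 * u ^ 3 =
        b 0 * (a 0 - a 1 * v + a 2 * \<mu> * v\<^sup>2 - a 3 * \<nu> * v ^ 3)"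
      using b01 by (simp add: c u_def \<mu>_def \<nu>_def field_simps power2_eq_square power3_eq_cube)
    have "a 0 - a 1 * v + a 2 * \<mu> * v\<^sup>2 - a 3 * \<nu> * v ^ 3 \<le> 0"
    proof -
      \<comment> \<open>The left-hand side decreases in \<open>\<nu>\<close>; for \<open>\<nu> = 2 \<mu> - 1\<close> it increases in \<open>\<mu>\<close> because
        \<open>2 a 3 v < a 2\<close>, and at \<open>\<mu> = 1\<close> it is the value of the cubic of \<open>a\<close> at \<open>v\<close>.\<close>
      have "a 3 * v ^ 3 * (2 * \<mu> - 1) \<le> a 3 * v ^ 3 * \<nu>"
        using \<nu> a v by (intro mult_left_mono) auto
      moreover have "0 \<le> (1 - \<mu>) * (v\<^sup>2 * (a 2 - 2 * a 3 * v))"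
        using \<mu> v by (intro mult_nonneg_nonneg) auto
      ultimately show ?thesis
        using v(3) by (simp add: algebra_simps power2_eq_square power3_eq_cube)
    qed
    then have fu0: "c 0 - c 1 * u + c 2 * u\<^sup>2 - c 3 * u ^ 3 \<le> 0"
      unfolding fu using b01 by (simp add: mult_nonneg_nonpos)
    show "c \<in> TP_inf"
    proof (cases "b 3 = 0")
      case True
      have q: "c 0 - c 1 * u + c 2 * u\<^sup>2 \<le> 0" using fu0 True by (simp add: c)
      have "4 * c 2 * (c 0 - c 1 * u + c 2 * u\<^sup>2) \<le> 0"
        using q c0[of 2] by (simp add: mult_nonneg_nonpos)
      moreover have "4 * c 2 * (c 0 - c 1 * u + c 2 * u\<^sup>2) =
          (2 * c 2 * u - c 1)\<^sup>2 - ((c 1)\<^sup>2 - 4 * c 0 * c 2)"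
        by (simp add: algebra_simps power2_eq_square)
      moreover have "0 \<le> (2 * c 2 * u - c 1)\<^sup>2" by simp
      ultimately have "4 * c 0 * c 2 \<le> (c 1)\<^sup>2" by linarith
      moreover have "c k = 0" if "k \<ge> 3" for k
        using czero that True by (cases "k = 3") (auto simp: c)
      ultimately show ?thesis by (intro TP_inf_quadratic c0) auto
    next
      case False
      then have b3: "0 < b 3" using b0[of 3] by simp
      then have "0 < b 1 * b 2" using b0123 b01 mult_pos_pos[of "b 3" "b 0"] by linarith
      then have b2: "0 < b 2" using b01 by (simp add: zero_less_mult_iff)
      have cpos: "\<forall>k\<le>3. 0 < c k"
      proof (intro allI impI)
        fix k :: nat
        assume "k \<le> 3"
        then consider "k = 0" | "k = 1" | "k = 2" | "k = 3" by linarith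
        then show "0 < c k" using a b01 b2 b3 by cases (auto simp: c)
      qed
      have "2 * c 3 * u = 2 * a 3 * v * (b 3 * b 0) / b 1" by (simp add: c u_def)
      also have "\<dots> \<le> 2 * a 3 * v * (b 1 * b 2) / b 1"
        using b0123 a v b01 by (intro divide_right_mono mult_left_mono) auto
      also have "\<dots> = 2 * a 3 * v * b 2" using b01 by simp
      also have "\<dots> < a 2 * b 2" using v b2 by simp
      finally have "2 * c 3 * u < c 2" by (simp add: c)
      then show ?thesis by (rule TP_inf_cubic_sign[OF cpos czero disc u _ fu0])
    qed
  qed
qed

section \<open>The characterization of the multiplier sequences\<close>

theorem theorem1p9:
  fixes a :: "nat \<Rightarrow> real"
  assumes nonneg: "\<forall>k. 0 \<le> a k"
    and pos: "\<forall>k\<le>3. 0 < a k"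
    and zero: "\<forall>k\<ge>4. a k = 0"
  shows "((\<forall>b\<in>TP_inf. Lam a b \<in> TP_inf) \<longleftrightarrow>
           only_real_nonpos_zeros (\<Sum>k=0..3. monom (a k) k) \<and>
           only_real_nonpos_zeros (\<Sum>k=1..3. monom (a k) k)) \<and>
         ((\<forall>b\<in>TP_inf. Lam a b \<in> TP_inf) \<longleftrightarrow> (\<forall>b\<in>TP 3. Lam a b \<in> TP_inf))"
proof -
  have "TP_inf \<subseteq> TP 3" by (auto simp: TP_inf_def TP_def)
  then show ?thesis
    using preserves_imp_zeros[OF pos zero] zeros_imp_preserves[OF pos zero] by blast
qed

end
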